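(* Let $G$ be a graph and let $G'$ be a graph obtained by an edge contraction from $G$. Then $\mathbb{K}[G']$ is a face retract of $\mathbb{K}[G]$.
   Context: $\mathbb{K}$ is a field. All graphs are finite and simple with non-empty vertex set. For a graph $G=(V,E)$ let $S_G=\mathbb{K}[q_{A|B}]$ be the polynomial ring with one variable for each unordered partition $A|B$ of $V$ (i.e. $A\cup B=V$, $A\cap B=\emptyset$, empty parts allowed), and $R_G=\mathbb{K}[s_{ij},t_{ij}:\{i,j\}\in E]$. Let $\mathrm{Cut}(A|B)\subseteq E$ be the set of edges with one endpoint in $A$ and the other in $B$. Let $\phi_G\colon S_G\to R_G$ be the $\mathbb{K}$-algebra homomorphism $q_{A|B}\mapsto u_{A|B}:=\prod_{\{i,j\}\in \mathrm{Cut}(A|B)}s_{ij}\prod_{\{i,j\}\in E\setminus \mathrm{Cut}(A|B)}t_{ij}$. The cut algebra $\mathbb{K}[G]\cong S_G/\ker\phi_G$ is the image of $\phi_G$, standard graded with $\deg u_{A|B}=1$. Here $G'$ is assumed to have at least one edge. Edge contraction: let $e=\{u,v\}\in E$. The graph $G'=(V',E')$ obtained by contracting $e$ has $V'=(V\setminus\{u,v\})\cup\{w\}$ with $w$ a new vertex and $E'=\{f\in E: f\cap\{u,v\}=\emptyset\}\cup\{\{w,z\}: z\in V\setminus\{u,v\},\ z \text{ adjacent in } G \text{ to } u \text{ or } v\}$. Cut polytope: $\mathrm{Cut}^{\square}(G)\subset\mathbb{R}^{|E|}$ is the convex hull of the cut vectors $\delta_A$, $A\subseteq V$, where $\delta_A(\{i,j\})=1$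 if $|A\cap\{i,j\}|=1$ and $0$ otherwise. Polytopal algebra: for a lattice polytope $P\subset\mathbb{R}^d$, $\mathbb{K}[P]=\mathbb{K}[y^{a}z: a\in P\cap\mathbb{Z}^d]\subseteq\mathbb{K}[y_1,\dots,y_d,z]$, standard graded with each $y^az$ of degree $1$. There is a natural isomorphism of standard graded algebras $\mathbb{K}[G]\cong\mathbb{K}[\mathrm{Cut}^{\square}(G)]$, sending $u_{A|B}$ to $z\prod_{\{i,j\}\in\mathrm{Cut}(A|B)}s_{ij}$. Face retract: for a face $F$ of $P$, the inclusion $\mathbb{K}[F]\to\mathbb{K}[P]$ together with the homomorphism $\pi\colon\mathbb{K}[P]\to\mathbb{K}[F]$, $\pi(y^az)=y^az$ if $a\in F$ and $\pi(y^az)=0$ if $a\in (P\cap\mathbb{Z}^d)\setminus F$, satisfies $\pi|_{\mathbb{K}[F]}=\mathrm{id}$; such an algebra retract is called a face retract. That $\mathbb{K}[G']$ is a face retract of $\mathbb{K}[G]$ means that there is a face $F$ of $\mathrm{Cut}^{\square}(G)$ and an isomorphism of standard graded $\mathbb{K}$-algebras $\mathbb{K}[G']\cong\mathbb{K}[F]$, so that, via $\mathbb{K}[G]\cong\mathbb{K}[\mathrm{Cut}^{\square}(G)]$, $\mathbb{K}[G']$ becomes the face retract of $\mathbb{K}[G]$ given by $F$. *)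

theory Defs
  imports "HOL-Analysis.Analysis" "HOL-Analysis.Finite_Function_Topology"
begin

section \<open>Graphs and edge contraction\<close>

record 'v graph =
  verts :: "'v set"
  edges :: "'v set set"

definition simple_graph :: "'v graph \<Rightarrow> bool" where
  "simple_graph G \<longleftrightarrow> finite (verts G) \<and> verts G \<noteq> {} \<and> (\<forall>e\<in>edges G. e \<subseteq> verts G \<and> card e = 2)"

definition contract :: "'v graph \<Rightarrow> 'v \<Rightarrow> 'v \<Rightarrow> 'v \<Rightarrow> 'v graph" where
  "contract G u v w =
     \<lparr>verts = (verts G - {u, v}) \<union> {w},
      edges = {f \<in> edges G. f \<inter> {u, v} = {}} \<union>
              {{w, z} | z. z \<in> verts G - {u, v} \<and> ({z, u} \<in> edges G \<or> {z, v} \<in> edges G)}\<rparr>"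

definition edge_contraction_of :: "'v graph \<Rightarrow> 'v graph \<Rightarrow> bool" where
  "edge_contraction_of G' G \<longleftrightarrow>
     (\<exists>u v w. {u, v} \<in> edges G \<and> w \<notin> verts G \<and> G' = contract G u v w)"

text \<open>The unordered partition $A|B$ is the set $\{A, B\}$; one of the parts may be empty.\<close>

definition partitions :: "'v set \<Rightarrow> 'v set set set" where
  "partitions V = {{A, B} | A B. A \<union> B = V \<and> A \<inter> B = {}}"

definition Cut :: "'v graph \<Rightarrow> 'v set set \<Rightarrow> 'v set set" where
  "Cut G p = {e \<in> edges G. \<exists>A B i j. p = {A, B} \<and> e = {i, j} \<and> i \<in> A \<and> j \<in> B}"

section \<open>Polynomial rings\<close>

text \<open>Polynomials over 'k in variables from 'x: finitely supported functions from exponent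
  vectors to coefficients, with the ring structure (convolution) of Poly_Mapping.\<close>

type_synonym ('x, 'k) mpoly = "('x \<Rightarrow>\<^sub>0 nat) \<Rightarrow>\<^sub>0 'k"

definition const :: "'k::comm_ring_1 \<Rightarrow> ('x, 'k) mpoly" where
  "const c = Poly_Mapping.single 0 c"

definition var :: "'x \<Rightarrow> ('x, 'k::comm_ring_1) mpoly" where
  "var x = Poly_Mapping.single (Poly_Mapping.single x 1) 1"

definition polys :: "'x set \<Rightarrow> ('x, 'k::comm_ring_1) mpoly set" where
  "polys X = {p. \<forall>m\<in>Poly_Mapping.keys p. Poly_Mapping.keys m \<subseteq> X}"

definition homogeneous :: "nat \<Rightarrow> ('x, 'k::comm_ring_1) mpoly \<Rightarrow> bool" where
  "homogeneous n p \<longleftrightarrow>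
     (\<forall>m\<in>Poly_Mapping.keys p. (\<Sum>x\<in>Poly_Mapping.keys m. Poly_Mapping.lookup m x) = n)"

text \<open>The algebra homomorphism between polynomial rings that sends each variable x to f x.\<close>

definition subst :: "('x \<Rightarrow> ('y, 'k) mpoly) \<Rightarrow> ('x, 'k::comm_ring_1) mpoly \<Rightarrow> ('y, 'k) mpoly" where
  "subst f p = (\<Sum>m\<in>Poly_Mapping.keys p. const (Poly_Mapping.lookup p m) *
                  (\<Prod>x\<in>Poly_Mapping.keys m. f x ^ Poly_Mapping.lookup m x))"

section \<open>Standard graded algebras\<close>

text \<open>Graded algebras are realised inside a polynomial ring: a subalgebra with its graded pieces.
  The grading is part of the data and need not be the one of the surrounding ring.\<close>

record 'r graded_algebra =
  carrier :: "'r set"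
  piece :: "nat \<Rightarrow> 'r set"

text \<open>The subalgebra generated by the elements f i with i in I, i.e. the image of the polynomial
  ring with one variable for each such i, graded so that every f i has degree 1.\<close>

definition generated :: "('i \<Rightarrow> ('y, 'k::comm_ring_1) mpoly) \<Rightarrow> 'i set \<Rightarrow> ('y, 'k) mpoly graded_algebra" where
  "generated f I = \<lparr>carrier = subst f ` polys I,
                    piece = (\<lambda>n. subst f ` {p \<in> polys I. homogeneous n p})\<rparr>"

definition graded_hom :: "('x, 'k::comm_ring_1) mpoly graded_algebra \<Rightarrow> ('y, 'k) mpoly graded_algebra \<Rightarrow>
    (('x, 'k) mpoly \<Rightarrow> ('y, 'k) mpoly) \<Rightarrow> bool" where
  "graded_hom R S h \<longleftrightarrow>
     (\<forall>a\<in>carrier R. h a \<in> carrier S) \<and>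
     (\<forall>a\<in>carrier R. \<forall>b\<in>carrier R. h (a + b) = h a + h b \<and> h (a * b) = h a * h b) \<and>
     h 1 = 1 \<and>
     (\<forall>c. \<forall>a\<in>carrier R. h (const c * a) = const c * h a) \<and>
     (\<forall>n. \<forall>a\<in>piece R n. h a \<in> piece S n)"

definition graded_iso :: "('x, 'k::comm_ring_1) mpoly graded_algebra \<Rightarrow> ('y, 'k) mpoly graded_algebra \<Rightarrow>
    (('x, 'k) mpoly \<Rightarrow> ('y, 'k) mpoly) \<Rightarrow> bool" where
  "graded_iso R S h \<longleftrightarrow>
     graded_hom R S h \<and> bij_betw h (carrier R) (carrier S) \<and> (\<forall>n. h ` piece R n = piece S n)"

definition algebra_retract :: "('x, 'k::comm_ring_1) mpoly graded_algebra \<Rightarrow> ('y, 'k) mpoly graded_algebra \<Rightarrow>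
    (('x, 'k) mpoly \<Rightarrow> ('y, 'k) mpoly) \<Rightarrow> (('y, 'k) mpoly \<Rightarrow> ('x, 'k) mpoly) \<Rightarrow> bool" where
  "algebra_retract R S \<iota> \<rho> \<longleftrightarrow>
     graded_hom R S \<iota> \<and> graded_hom S R \<rho> \<and> (\<forall>a\<in>carrier R. \<rho> (\<iota> a) = a)"

section \<open>Cut algebras\<close>

datatype 'e stvar = SV 'e | TV 'e

definition cut_monomial :: "'v graph \<Rightarrow> 'v set set \<Rightarrow> ('v set stvar, 'k::field) mpoly" where
  "cut_monomial G p = (\<Prod>e\<in>Cut G p. var (SV e)) * (\<Prod>e\<in>edges G - Cut G p. var (TV e))"

definition cut_algebra :: "'v graph \<Rightarrow> ('v set stvar, 'k::field) mpoly graded_algebra" where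
  "cut_algebra G = generated (cut_monomial G) (partitions (verts G))"

section \<open>Polytopal algebras and face retracts\<close>

datatype 'e yzvar = YV 'e | ZV

text \<open>The space of finitely supported functions 'e to the reals contains $\mathbb{R}^E$ for every
  finite set E as the coordinate subspace of functions supported in E. As the monomials
  $y^a z$ live in a polynomial ring, polytopes are understood to lie in the nonnegative
  orthant, and lattice points are exponent vectors.\<close>

definition lattice_points :: "('e \<Rightarrow>\<^sub>0 real) set \<Rightarrow> ('e \<Rightarrow>\<^sub>0 nat) set" where
  "lattice_points P = {a. Poly_Mapping.map real a \<in> P}"

definition yz_monomial :: "('e \<Rightarrow>\<^sub>0 nat) \<Rightarrow> ('e yzvar, 'k::field) mpoly" where
  "yz_monomial a = (\<Prod>e\<in>Poly_Mapping.keys a. var (YV e) ^ Poly_Mapping.lookup a e) * var ZV"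

definition polytopal_algebra :: "('e \<Rightarrow>\<^sub>0 real) set \<Rightarrow> ('e yzvar, 'k::field) mpoly graded_algebra" where
  "polytopal_algebra P = generated yz_monomial (lattice_points P)"

definition face_projection :: "('e \<Rightarrow>\<^sub>0 real) set \<Rightarrow> ('e \<Rightarrow>\<^sub>0 real) set \<Rightarrow>
    (('e yzvar, 'k::field) mpoly \<Rightarrow> ('e yzvar, 'k) mpoly) \<Rightarrow> bool" where
  "face_projection P F \<pi> \<longleftrightarrow>
     algebra_retract (polytopal_algebra F) (polytopal_algebra P) id \<pi> \<and>
     (\<forall>a\<in>lattice_points P.
        \<pi> (yz_monomial a) = (if a \<in> lattice_points F then yz_monomial a else 0))"

text \<open>R is a face retract of S, where S is identified with the polytopal algebra of P via the
  isomorphism \<open>\<Phi>\<close>: under \<open>\<Phi>\<close> and an isomorphism \<open>\<Psi>\<close> of R with the polytopal algebra of a face F,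
  the retract given by \<open>\<iota>\<close> and \<open>\<rho>\<close> becomes the inclusion and the projection belonging to F.\<close>

definition face_retract :: "('x, 'k::field) mpoly graded_algebra \<Rightarrow> ('y, 'k) mpoly graded_algebra \<Rightarrow>
    ('e \<Rightarrow>\<^sub>0 real) set \<Rightarrow> (('y, 'k) mpoly \<Rightarrow> ('e yzvar, 'k) mpoly) \<Rightarrow> bool" where
  "face_retract R S P \<Phi> \<longleftrightarrow>
     (\<exists>F \<pi> \<Psi> \<iota> \<rho>.
        F face_of P \<and>
        face_projection P F \<pi> \<and>
        graded_iso R (polytopal_algebra F) \<Psi> \<and>
        algebra_retract R S \<iota> \<rho> \<and>
        (\<forall>a\<in>carrier R. \<Phi> (\<iota> a) = \<Psi> a) \<and>
        (\<forall>b\<in>carrier S. \<Psi> (\<rho> b) = \<pi> (\<Phi> b)))"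

section \<open>Cut polytopes\<close>

definition cut_vector :: "'v graph \<Rightarrow> 'v set \<Rightarrow> ('v set \<Rightarrow>\<^sub>0 real)" where
  "cut_vector G A = (\<Sum>e\<in>{e \<in> edges G. card (A \<inter> e) = 1}. Poly_Mapping.single e 1)"

definition cut_polytope :: "'v graph \<Rightarrow> ('v set \<Rightarrow>\<^sub>0 real) set" where
  "cut_polytope G = convex hull {cut_vector G A | A. A \<subseteq> verts G}"

text \<open>The conditions determine \<open>\<Phi>\<close> on the cut algebra, since the cut monomials generate it.\<close>

definition natural_cut_iso :: "'v graph \<Rightarrow>
    (('v set stvar, 'k::field) mpoly \<Rightarrow> ('v set yzvar, 'k) mpoly) \<Rightarrow> bool" where
  "natural_cut_iso G \<Phi> \<longleftrightarrow>
     graded_iso (cut_algebra G) (polytopal_algebra (cut_polytope G)) \<Phi> \<and>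
     (\<forall>p\<in>partitions (verts G). \<Phi> (cut_monomial G p) = var ZV * (\<Prod>e\<in>Cut G p. var (YV e)))"

end

theory Submission
  imports Defs
begin

text \<open>The face is cut out of the cut polytope by the coordinate of the contracted edge
  $e = \{u, v\}$: since $x_e \geq 0$ on the polytope, $x_e = 0$ defines a face, and its lattice
  points are the cut vectors of the cuts of $G$ that do not separate $u$ and $v$. These are the
  pullbacks of the cuts of $G'$.

  Every map between the algebras is induced by a substitution of variables. The grading variable
  $z$ is produced by attaching it to a single edge $e_0$: substitute $s_d \mapsto y_d$ and
  $t_d \mapsto 1$ for all edges $d$, with an extra factor $z$ in the images of $s_{e_0}$ and
  $t_{e_0}$. For $G'$ the variable $s_f$ goes to the product of the $y_d$ over all edges $d$ of $G$
  that are contracted to $f$. This is injective on the cut algebra because in all of its monomials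
  the sum of the exponents of $s_d$ and $t_d$ is independent of $d$.\<close>

section \<open>Substitution homomorphisms\<close>

lemma poly_mapping_sum_singles:
  fixes p :: "'a \<Rightarrow>\<^sub>0 'b::comm_monoid_add"
  shows "p = (\<Sum>m\<in>Poly_Mapping.keys p. Poly_Mapping.single m (Poly_Mapping.lookup p m))"
  by (rule poly_mapping_eqI)
    (auto simp: lookup_sum lookup_single when_def in_keys_iff)

lemma poly_mapping_plus_induct [case_names single plus]:
  fixes p :: "'a \<Rightarrow>\<^sub>0 'b::comm_monoid_add"
  assumes "\<And>m c. P (Poly_Mapping.single m c)" and "\<And>p q. P p \<Longrightarrow> P q \<Longrightarrow> P (p + q)"
  shows "P p"
proof -
  have "P (\<Sum>m\<in>A. Poly_Mapping.single m (Poly_Mapping.lookup p m))" if "finite A" for A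
    using that
  proof induction
    case empty
    \<comment> \<open>Zero is a single term with coefficient 0, at an arbitrary key, so the
      \<open>single\<close> case covers it.\<close>
    show ?case using assms(1)[of undefined 0] by simp
  qed (simp add: assms)
  then show ?thesis
    by (subst poly_mapping_sum_singles) simp
qed

definition eval_monomial :: "('x \<Rightarrow> ('y, 'k::comm_ring_1) mpoly) \<Rightarrow> ('x \<Rightarrow>\<^sub>0 nat) \<Rightarrow> ('y, 'k) mpoly" where
  "eval_monomial f m = (\<Prod>x\<in>Poly_Mapping.keys m. f x ^ Poly_Mapping.lookup m x)"

text \<open>Factors outside the support are zeroth powers. Enlarging the index set puts two
  monomials over a common set, as their product requires.\<close>

lemma eval_monomial_superset:
  assumes "finite A" "Poly_Mapping.keys m \<subseteq> A"
  shows "eval_monomial f m = (\<Prod>x\<in>A. f x ^ Poly_Mapping.lookup m x)"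
  unfolding eval_monomial_def
  by (rule prod.mono_neutral_left) (use assms in \<open>auto simp: in_keys_iff\<close>)

lemma eval_monomial_zero [simp]: "eval_monomial f 0 = 1"
  by (simp add: eval_monomial_def)

lemma eval_monomial_add: "eval_monomial f (m + n) = eval_monomial f m * eval_monomial f n"
proof -
  let ?A = "Poly_Mapping.keys m \<union> Poly_Mapping.keys n"
  have "eval_monomial f (m + n) = (\<Prod>x\<in>?A. f x ^ Poly_Mapping.lookup (m + n) x)"
    by (rule eval_monomial_superset) (auto simp: keys_add)
  also have "\<dots> = (\<Prod>x\<in>?A. f x ^ Poly_Mapping.lookup m x) * (\<Prod>x\<in>?A. f x ^ Poly_Mapping.lookup n x)"
    by (simp add: lookup_add power_add prod.distrib)
  also have "\<dots> = eval_monomial f m * eval_monomial f n"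
    by (simp add: eval_monomial_superset[of ?A])
  finally show ?thesis .
qed

lemma const_add: "const (a + b) = const a + const b"
  and const_mult: "const (a * b) = const a * const b"
  and const_0 [simp]: "const 0 = 0"
  and const_1 [simp]: "const 1 = 1"
  by (simp_all add: const_def single_add mult_single)

lemma subst_eval_monomial:
  "subst f p = (\<Sum>m\<in>Poly_Mapping.keys p. const (Poly_Mapping.lookup p m) * eval_monomial f m)"
  by (simp add: subst_def eval_monomial_def)

lemma subst_superset:
  assumes "finite A" "Poly_Mapping.keys p \<subseteq> A"
  shows "subst f p = (\<Sum>m\<in>A. const (Poly_Mapping.lookup p m) * eval_monomial f m)"
  unfolding subst_eval_monomial
  by (rule sum.mono_neutral_left) (use assms in \<open>auto simp: in_keys_iff\<close>)

lemma subst_single: "subst f (Poly_Mapping.single m c) = const c * eval_monomial f m"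
  by (subst subst_superset[of "{m}"]) auto

lemma subst_add: "subst f (p + q) = subst f p + subst f q"
proof -
  let ?A = "Poly_Mapping.keys p \<union> Poly_Mapping.keys q"
  have "subst f (p + q) = (\<Sum>m\<in>?A. const (Poly_Mapping.lookup (p + q) m) * eval_monomial f m)"
    by (rule subst_superset) (auto simp: keys_add)
  also have "\<dots> = subst f p + subst f q"
    by (simp add: subst_superset[of ?A] lookup_add const_add ring_distribs sum.distrib)
  finally show ?thesis .
qed

text \<open>Both sides are additive in \<open>p\<close> and in \<open>q\<close>, so it suffices to
  compare single terms, where \<open>eval_monomial_add\<close> applies.\<close>

lemma subst_mult: "subst f (p * q) = subst f p * subst f q"
proof (induction p rule: poly_mapping_plus_induct)
  case (single m c)
  show ?case
    by (induction q rule: poly_mapping_plus_induct)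
      (simp_all add: mult_single subst_single const_mult eval_monomial_add subst_add ring_distribs mult_ac)
qed (simp add: subst_add ring_distribs)

lemma subst_0 [simp]: "subst f 0 = 0"
  by (simp add: subst_def)

lemma subst_const [simp]: "subst f (const c) = const c"
  unfolding const_def[of c] subst_single by (simp add: const_def)

lemma subst_1 [simp]: "subst f 1 = 1"
  using subst_const[of f 1] by simp

lemma subst_var [simp]: "subst f (var x) = f x"
  by (simp add: var_def subst_single eval_monomial_def)

lemma subst_sum: "subst f (sum g A) = (\<Sum>x\<in>A. subst f (g x))"
  by (induction A rule: infinite_finite_induct) (auto simp: subst_add)

lemma subst_prod: "subst f (prod g A) = (\<Prod>x\<in>A. subst f (g x))"
  by (induction A rule: infinite_finite_induct) (auto simp: subst_mult)

lemma subst_power: "subst f (p ^ n) = subst f p ^ n"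
  by (induction n) (auto simp: subst_mult)

text \<open>With \<open>subst_cong\<close>, this reduces an identity between maps on a generated
  algebra to an identity on the generators.\<close>

lemma subst_subst: "subst f (subst g p) = subst (\<lambda>x. subst f (g x)) p"
  by (simp add: subst_def[of g] subst_def[of "\<lambda>x. subst f (g x)"] subst_sum subst_mult subst_prod subst_power)

lemma subst_cong:
  assumes "p \<in> polys X" "\<And>x. x \<in> X \<Longrightarrow> f x = g x"
  shows "subst f p = subst g p"
  unfolding subst_def
proof (rule sum.cong[OF refl])
  fix m assume "m \<in> Poly_Mapping.keys p"
  then have "Poly_Mapping.keys m \<subseteq> X" using assms(1) by (auto simp: polys_def)
  then show "const (Poly_Mapping.lookup p m) * (\<Prod>x\<in>Poly_Mapping.keys m. f x ^ Poly_Mapping.lookup m x)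
     = const (Poly_Mapping.lookup p m) * (\<Prod>x\<in>Poly_Mapping.keys m. g x ^ Poly_Mapping.lookup m x)"
    using assms(2) by (intro arg_cong2[where f = "(*)"] refl prod.cong) (auto simp: subset_iff)
qed

section \<open>Polynomials supported in a set of monomials\<close>

lemma polys_eq: "polys X = {p. Poly_Mapping.keys p \<subseteq> {m. Poly_Mapping.keys m \<subseteq> X}}"
  by (auto simp: polys_def)

definition mdeg :: "('x \<Rightarrow>\<^sub>0 nat) \<Rightarrow> nat" where
  "mdeg m = (\<Sum>x\<in>Poly_Mapping.keys m. Poly_Mapping.lookup m x)"

lemma mdeg_add: "mdeg (m + n) = mdeg m + mdeg n"
  unfolding mdeg_def by (rule setsum_keys_plus_distrib) auto

lemma homogeneous_eq: "homogeneous n p \<longleftrightarrow> Poly_Mapping.keys p \<subseteq> {m. mdeg m = n}"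
  by (auto simp: homogeneous_def mdeg_def)

text \<open>Polynomials supported in a submonoid of exponent vectors form a subalgebra. This covers
  both the polynomials in a given set of variables and an ambient algebra for the cut
  monomials.\<close>

definition submonoid :: "'a::monoid_add set \<Rightarrow> bool" where
  "submonoid M \<longleftrightarrow> 0 \<in> M \<and> (\<forall>a\<in>M. \<forall>b\<in>M. a + b \<in> M)"

lemma submonoid_keys: "submonoid {m :: 'x \<Rightarrow>\<^sub>0 nat. Poly_Mapping.keys m \<subseteq> X}"
  unfolding submonoid_def by (auto dest!: subsetD[OF keys_add])

context
  fixes M :: "('x \<Rightarrow>\<^sub>0 nat) set"
  assumes M: "submonoid M"
begin

lemma keys_mult_subset:
  assumes "Poly_Mapping.keys p \<subseteq> M" "Poly_Mapping.keys q \<subseteq> M"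
  shows "Poly_Mapping.keys (p * q) \<subseteq> M"
  using assms M unfolding submonoid_def by (auto dest!: subsetD[OF keys_mult])

lemma zero_mem_M: "0 \<in> M"
  using M by (simp add: submonoid_def)

lemma keys_const_subset: "Poly_Mapping.keys (const c :: ('x, 'k::comm_ring_1) mpoly) \<subseteq> M"
  using M by (simp add: submonoid_def const_def)

lemma keys_power_subset:
  "Poly_Mapping.keys (p :: ('x, 'k::comm_ring_1) mpoly) \<subseteq> M \<Longrightarrow> Poly_Mapping.keys (p ^ n) \<subseteq> M"
  by (induction n) (simp_all add: zero_mem_M keys_mult_subset)

lemma keys_prod_subset:
  fixes f :: "'a \<Rightarrow> ('x, 'k::comm_ring_1) mpoly"
  shows "(\<And>x. x \<in> A \<Longrightarrow> Poly_Mapping.keys (f x) \<subseteq> M) \<Longrightarrow> Poly_Mapping.keys (prod f A) \<subseteq> M"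
  by (induction A rule: infinite_finite_induct) (simp_all add: zero_mem_M keys_mult_subset)

lemma keys_sum_subset:
  fixes f :: "'a \<Rightarrow> ('x, 'k::comm_ring_1) mpoly"
  shows "(\<And>x. x \<in> A \<Longrightarrow> Poly_Mapping.keys (f x) \<subseteq> M) \<Longrightarrow> Poly_Mapping.keys (sum f A) \<subseteq> M"
  using keys_sum[of f A] by blast

lemma keys_subst_subset:
  fixes f :: "'a \<Rightarrow> ('x, 'k::comm_ring_1) mpoly"
  assumes "p \<in> polys X" "\<And>x. x \<in> X \<Longrightarrow> Poly_Mapping.keys (f x) \<subseteq> M"
  shows "Poly_Mapping.keys (subst f p) \<subseteq> M"
  unfolding subst_def
  by (intro keys_sum_subset keys_mult_subset keys_const_subset keys_prod_subset keys_power_subset)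
    (use assms in \<open>auto simp: polys_def\<close>)

end

section \<open>Homogeneous polynomials\<close>

lemma homogeneous_mult: "homogeneous a p \<Longrightarrow> homogeneous b q \<Longrightarrow> homogeneous (a + b) (p * q)"
  unfolding homogeneous_eq by (fastforce simp: mdeg_add dest: subsetD[OF keys_mult])

lemma homogeneous_const: "homogeneous 0 (const c)"
  by (simp add: homogeneous_def const_def)

lemma homogeneous_1: "homogeneous 0 1"
  using homogeneous_const[of 1] by simp

lemma homogeneous_power: "homogeneous a p \<Longrightarrow> homogeneous (n * a) (p ^ n)"
  by (induction n) (auto intro: homogeneous_1 homogeneous_mult)

lemma homogeneous_prod:
  "(\<And>x. x \<in> A \<Longrightarrow> homogeneous (d x) (f x)) \<Longrightarrow> homogeneous (sum d A) (prod f A)"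
  by (induction A rule: infinite_finite_induct) (auto intro: homogeneous_1 homogeneous_mult)

lemma homogeneous_sum: "(\<And>x. x \<in> A \<Longrightarrow> homogeneous n (f x)) \<Longrightarrow> homogeneous n (sum f A)"
  unfolding homogeneous_eq using keys_sum[of f A] by blast

lemma homogeneous_0 [simp]: "homogeneous n 0"
  by (simp add: homogeneous_def)

lemma homogeneous_var [simp]: "homogeneous 1 (var x)"
  by (simp add: homogeneous_def var_def)

lemma homogeneous_subst:
  assumes "p \<in> polys X" "homogeneous n p" "\<And>x. x \<in> X \<Longrightarrow> homogeneous 1 (f x)"
  shows "homogeneous n (subst f p)"
  unfolding subst_def
proof (rule homogeneous_sum)
  fix m assume m: "m \<in> Poly_Mapping.keys p"
  \<comment> \<open>The factor 1 is the degree of each \<open>f x\<close>; it is kept to match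
    \<open>homogeneous_power\<close>.\<close>
  have "homogeneous (\<Sum>x\<in>Poly_Mapping.keys m. Poly_Mapping.lookup m x * 1)
      (\<Prod>x\<in>Poly_Mapping.keys m. f x ^ Poly_Mapping.lookup m x)"
    by (intro homogeneous_prod homogeneous_power) (use assms m in \<open>auto simp: polys_def\<close>)
  moreover have "(\<Sum>x\<in>Poly_Mapping.keys m. Poly_Mapping.lookup m x) = n"
    using assms(2) m by (auto simp: homogeneous_def)
  ultimately show "homogeneous n (const (Poly_Mapping.lookup p m) *
      (\<Prod>x\<in>Poly_Mapping.keys m. f x ^ Poly_Mapping.lookup m x))"
    using homogeneous_mult[OF homogeneous_const] by fastforce
qed

section \<open>Closure properties of polynomials in a set of variables\<close>

lemma var_in_polys: "x \<in> X \<Longrightarrow> var x \<in> polys X"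
  by (simp add: polys_def var_def)

lemma zero_in_polys [simp]: "0 \<in> polys X"
  by (simp add: polys_def)

lemma const_in_polys [simp]: "const c \<in> polys X"
  by (simp add: polys_def const_def)

lemma add_in_polys: "p \<in> polys X \<Longrightarrow> q \<in> polys X \<Longrightarrow> p + q \<in> polys X"
  unfolding polys_eq by (auto dest!: subsetD[OF keys_add])

lemma mult_in_polys: "p \<in> polys X \<Longrightarrow> q \<in> polys X \<Longrightarrow> p * q \<in> polys X"
  unfolding polys_eq using keys_mult_subset[OF submonoid_keys] by blast

lemma subst_in_polys: "p \<in> polys X \<Longrightarrow> (\<And>x. x \<in> X \<Longrightarrow> f x \<in> polys Y) \<Longrightarrow> subst f p \<in> polys Y"
  unfolding polys_eq[of Y] using keys_subst_subset[OF submonoid_keys] by blast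

section \<open>Monomial substitutions\<close>

text \<open>The additive extension of \<gamma> to exponent vectors. The sum over \<open>i\<close>
  expresses the multiple of \<open>\<gamma> x\<close> by the exponent of \<open>x\<close>.\<close>

definition monomial_map :: "('x \<Rightarrow> ('y \<Rightarrow>\<^sub>0 nat)) \<Rightarrow> ('x \<Rightarrow>\<^sub>0 nat) \<Rightarrow> ('y \<Rightarrow>\<^sub>0 nat)" where
  "monomial_map \<gamma> m = (\<Sum>x\<in>Poly_Mapping.keys m. \<Sum>i<Poly_Mapping.lookup m x. \<gamma> x)"

lemma lookup_monomial_map:
  assumes "finite A" "Poly_Mapping.keys m \<subseteq> A"
  shows "Poly_Mapping.lookup (monomial_map \<gamma> m) y =
    (\<Sum>x\<in>A. Poly_Mapping.lookup m x * Poly_Mapping.lookup (\<gamma> x) y)"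
proof -
  have "Poly_Mapping.lookup (monomial_map \<gamma> m) y =
      (\<Sum>x\<in>Poly_Mapping.keys m. Poly_Mapping.lookup m x * Poly_Mapping.lookup (\<gamma> x) y)"
    by (simp add: monomial_map_def lookup_sum)
  also have "\<dots> = (\<Sum>x\<in>A. Poly_Mapping.lookup m x * Poly_Mapping.lookup (\<gamma> x) y)"
    by (rule sum.mono_neutral_left) (use assms in \<open>auto simp: in_keys_iff\<close>)
  finally show ?thesis .
qed

lemma prod_single:
  "(\<Prod>x\<in>A. Poly_Mapping.single (\<gamma> x) (1::'k::comm_ring_1)) = Poly_Mapping.single (\<Sum>x\<in>A. \<gamma> x) 1"
  by (induction A rule: infinite_finite_induct) (simp_all add: mult_single)

lemma eval_monomial_single:
  fixes \<gamma> :: "'x \<Rightarrow> ('y \<Rightarrow>\<^sub>0 nat)"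
  shows "eval_monomial (\<lambda>x. Poly_Mapping.single (\<gamma> x) (1::'k::comm_ring_1)) m
     = Poly_Mapping.single (monomial_map \<gamma> m) 1"
proof -
  have "Poly_Mapping.single a (1::'k) ^ n = Poly_Mapping.single (\<Sum>i<n. a) 1" for a :: "'y \<Rightarrow>\<^sub>0 nat" and n
    using prod_single[of "\<lambda>_. a" "{..<n}"] by simp
  then show ?thesis
    by (simp only: eval_monomial_def monomial_map_def prod_single)
qed

text \<open>Distinct monomials from \<open>M\<close> have distinct images, so nothing cancels and
  every coefficient can be read off from the image polynomial.\<close>

lemma subst_monomial_inj_on:
  assumes "inj_on (monomial_map \<gamma>) M"
  shows "inj_on (subst (\<lambda>x. Poly_Mapping.single (\<gamma> x) (1::'k::comm_ring_1))) {p. Poly_Mapping.keys p \<subseteq> M}"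
proof -
  let ?h = "subst (\<lambda>x. Poly_Mapping.single (\<gamma> x) (1::'k))"
  have *: "Poly_Mapping.lookup (?h p) (monomial_map \<gamma> m) = Poly_Mapping.lookup p m"
    if "Poly_Mapping.keys p \<subseteq> M" "m \<in> M" for p m
  proof -
    have "Poly_Mapping.lookup (?h p) (monomial_map \<gamma> m) =
        (\<Sum>n\<in>Poly_Mapping.keys p. Poly_Mapping.lookup p n when monomial_map \<gamma> n = monomial_map \<gamma> m)"
      by (simp add: subst_eval_monomial eval_monomial_single const_def mult_single lookup_sum lookup_single)
    also have "\<dots> = (\<Sum>n\<in>Poly_Mapping.keys p. Poly_Mapping.lookup p n when n = m)"
      by (rule sum.cong) (use assms that in \<open>auto simp: inj_on_def when_def\<close>)
    also have "\<dots> = Poly_Mapping.lookup p m"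
      by (auto simp: when_def in_keys_iff)
    finally show ?thesis .
  qed
  show ?thesis
  proof (rule inj_onI, clarsimp, rule poly_mapping_eqI)
    fix p q :: "('a, 'k) mpoly" and m
    assume p: "Poly_Mapping.keys p \<subseteq> M" and q: "Poly_Mapping.keys q \<subseteq> M" and eq: "?h p = ?h q"
    show "Poly_Mapping.lookup p m = Poly_Mapping.lookup q m"
    proof (cases "m \<in> M")
      case True
      then show ?thesis using *[OF p] *[OF q] eq by metis
    next
      case False
      then have "Poly_Mapping.lookup p m = 0" "Poly_Mapping.lookup q m = 0"
        using p q by (meson in_keys_iff subsetD)+
      then show ?thesis by simp
    qed
  qed
qed

section \<open>Generated algebras\<close>

lemma carrier_generated: "carrier (generated f I) = subst f ` polys I"
  and piece_generated: "piece (generated f I) n = subst f ` {p \<in> polys I. homogeneous n p}"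
  by (simp_all add: generated_def)

lemma carrier_generated_closed:
  assumes "a \<in> carrier (generated f I)" "b \<in> carrier (generated f I)"
  shows "a + b \<in> carrier (generated f I)" "a * b \<in> carrier (generated f I)"
  using assms unfolding carrier_generated
  by (auto simp flip: subst_add subst_mult intro!: imageI add_in_polys mult_in_polys)

lemma const_in_carrier_generated: "const c \<in> carrier (generated f I)"
  unfolding carrier_generated by (rule image_eqI[of _ _ "const c"]) simp_all

lemma piece_generated_subset: "piece (generated f I) n \<subseteq> carrier (generated f I)"
  by (auto simp: carrier_generated piece_generated)

lemma subst_generated:
  assumes "\<And>i. i \<in> I \<Longrightarrow> subst h (f i) = subst f' (r i)" "p \<in> polys I"
  shows "subst h (subst f p) = subst f' (subst r p)"
  unfolding subst_subst using assms by (intro subst_cong)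

text \<open>\<open>r i\<close> lifts the image of the generator \<open>f i\<close> to the polynomial
  ring presenting the target. Allowing any linear form, not only a variable, lets generators be sent
  to 0, as the face projection does.\<close>

lemma graded_hom_subst:
  assumes "\<And>i. i \<in> I \<Longrightarrow> subst h (f i) = subst f' (r i)"
    and r: "\<And>i. i \<in> I \<Longrightarrow> r i \<in> polys J" "\<And>i. i \<in> I \<Longrightarrow> homogeneous 1 (r i)"
  shows "graded_hom (generated f I) (generated f' J) (subst h)"
proof -
  have *: "subst h (subst f p) = subst f' (subst r p)" if "p \<in> polys I" for p
    using assms(1) that by (rule subst_generated)
  have "subst h a \<in> carrier (generated f' J)" if a: "a \<in> carrier (generated f I)" for a
  proof -
    obtain p where p: "p \<in> polys I" "a = subst f p"
      using a unfolding carrier_generated by blast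
    show ?thesis
      unfolding p(2) *[OF p(1)] carrier_generated
      by (intro imageI subst_in_polys[OF p(1)] r)
  qed
  moreover have "subst h a \<in> piece (generated f' J) n" if a: "a \<in> piece (generated f I) n" for a n
  proof -
    obtain p where p: "p \<in> polys I" "homogeneous n p" "a = subst f p"
      using a unfolding piece_generated by blast
    show ?thesis
      unfolding p(3) *[OF p(1)] piece_generated
      by (intro imageI CollectI conjI subst_in_polys[OF p(1)] homogeneous_subst[OF p(1,2)] r)
  qed
  ultimately show ?thesis
    by (simp add: graded_hom_def subst_add subst_mult)
qed

text \<open>Injectivity restricts from the ambient algebra of polynomials supported in
  \<open>M\<close>. Surjectivity, also in each degree, holds because generators are mapped onto
  generators; several generators may coincide, so the index sets need not correspond
  bijectively.\<close>

lemma graded_iso_subst: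
  fixes f :: "'i \<Rightarrow> ('y, 'k::comm_ring_1) mpoly" and f' :: "'j \<Rightarrow> ('z, 'k) mpoly"
  assumes M: "submonoid M" "\<And>i. i \<in> I \<Longrightarrow> Poly_Mapping.keys (f i) \<subseteq> M"
    and inj: "inj_on (subst h) {p. Poly_Mapping.keys p \<subseteq> M}"
    and image: "(\<lambda>i. subst h (f i)) ` I = f' ` J"
  shows "graded_iso (generated f I) (generated f' J) (subst h)"
proof -
  have "\<forall>i\<in>I. \<exists>j. j \<in> J \<and> subst h (f i) = f' j" using image by blast
  from bchoice[OF this] obtain \<sigma> where \<sigma>: "\<forall>i\<in>I. \<sigma> i \<in> J \<and> subst h (f i) = f' (\<sigma> i)"
    by blast
  have "\<forall>j\<in>J. \<exists>i. i \<in> I \<and> subst h (f i) = f' j" using image by (metis (no_types, lifting) imageE imageI)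
  from bchoice[OF this] obtain \<tau> where \<tau>: "\<forall>j\<in>J. \<tau> j \<in> I \<and> subst h (f (\<tau> j)) = f' j"
    by blast
  \<comment> \<open>Renaming variables along the chosen preimages \<tau> preserves degrees, so one
    lift proves surjectivity for the carrier and for every graded piece.\<close>
  let ?lift = "subst (\<lambda>j. var (\<tau> j))"
  have hom: "graded_hom (generated f I) (generated f' J) (subst h)"
    by (rule graded_hom_subst[where r = "\<lambda>i. var (\<sigma> i)"])
      (use \<sigma> in \<open>simp_all add: var_in_polys del: One_nat_def\<close>)
  have lift: "subst f' q = subst h (subst f (?lift q))" if q: "q \<in> polys J" for q
    unfolding subst_subst by (rule subst_cong[OF q]) (use \<tau> in simp)
  have lift_polys: "?lift q \<in> polys I" if q: "q \<in> polys J" for q :: "('j, 'k) mpoly"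
    by (rule subst_in_polys[OF q]) (use \<tau> in \<open>simp add: var_in_polys\<close>)
  have "carrier (generated f' J) \<subseteq> subst h ` carrier (generated f I)"
    unfolding carrier_generated
  proof (rule image_subsetI)
    fix q :: "('j, 'k) mpoly" assume q: "q \<in> polys J"
    show "subst f' q \<in> subst h ` subst f ` polys I"
      unfolding lift[OF q] by (intro imageI lift_polys[OF q])
  qed
  moreover have "piece (generated f' J) n \<subseteq> subst h ` piece (generated f I) n" for n
    unfolding piece_generated
  proof (rule image_subsetI, clarify)
    fix q :: "('j, 'k) mpoly" assume q: "q \<in> polys J" "homogeneous n q"
    show "subst f' q \<in> subst h ` subst f ` {p \<in> polys I. homogeneous n p}"
      unfolding lift[OF q(1)]
      by (intro imageI CollectI conjI lift_polys[OF q(1)] homogeneous_subst[OF q] homogeneous_var)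
  qed
  moreover have "carrier (generated f I) \<subseteq> {p. Poly_Mapping.keys p \<subseteq> M}"
    unfolding carrier_generated
  proof (rule image_subsetI, rule CollectI)
    fix p :: "('i, 'k) mpoly" assume "p \<in> polys I"
    then show "Poly_Mapping.keys (subst f p) \<subseteq> M"
      using M(2) by (rule keys_subst_subset[OF M(1)])
  qed
  then have "inj_on (subst h) (carrier (generated f I))"
    by (rule inj_on_subset[OF inj])
  moreover have "subst h ` carrier (generated f I) \<subseteq> carrier (generated f' J)"
    and "subst h ` piece (generated f I) n \<subseteq> piece (generated f' J) n" for n
    using hom by (auto simp: graded_hom_def)
  ultimately show ?thesis
    using hom unfolding graded_iso_def bij_betw_def by blast
qed

lemma graded_hom_comp:
  assumes "graded_hom R S f" "graded_hom S T g"
  shows "graded_hom R T (g \<circ> f)"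
  using assms by (auto simp: graded_hom_def)

text \<open>Each law for the inverse follows from the law for \<open>h\<close> by injectivity, once
  the candidate preimage is known to lie in the carrier. Closure of generated algebras provides
  this; degrees are kept because \<open>h\<close> maps each piece onto its counterpart.\<close>

lemma graded_hom_inv_into:
  assumes iso: "graded_iso (generated f I) (generated f' J) h"
  shows "graded_hom (generated f' J) (generated f I) (inv_into (carrier (generated f I)) h)"
proof -
  let ?R = "generated f I" and ?S = "generated f' J"
  let ?g = "inv_into (carrier ?R) h"
  have inj: "inj_on h (carrier ?R)" and im: "h ` carrier ?R = carrier ?S"
    and piece: "h ` piece ?R n = piece ?S n" and hom: "graded_hom ?R ?S h" for n
    using iso by (auto simp: graded_iso_def bij_betw_def)
  have g: "?g b \<in> carrier ?R" "h (?g b) = b" if "b \<in> carrier ?S" for b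
    using that im by (metis inv_into_into, metis f_inv_into_f)
  have eqI: "?g b = a" if "a \<in> carrier ?R" "h a = b" for a b
    using that inj by auto
  have h: "h (a + b) = h a + h b" "h (a * b) = h a * h b"
    if "a \<in> carrier ?R" "b \<in> carrier ?R" for a b
    using hom that by (simp_all add: graded_hom_def)
  have h_const: "h (const c * a) = const c * h a" if "a \<in> carrier ?R" for c a
    using hom that by (simp add: graded_hom_def)
  have h_1: "h 1 = 1" using hom by (simp add: graded_hom_def)
  have one: "1 \<in> carrier ?R" using const_in_carrier_generated[of 1] by simp
  show ?thesis
    unfolding graded_hom_def
  proof (intro conjI ballI allI)
    show "?g 1 = 1" using one h_1 by (rule eqI)
  next
    fix n a assume "a \<in> piece ?S n"
    then obtain b where "b \<in> piece ?R n" "a = h b" using piece by blast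
    then show "?g a \<in> piece ?R n"
      using eqI piece_generated_subset[of f I n] by auto
  next
    fix c a assume a: "a \<in> carrier ?S"
    show "?g (const c * a) = const c * ?g a"
      by (rule eqI) (simp_all add: h_const g[OF a] carrier_generated_closed const_in_carrier_generated)
  next
    fix a b assume a: "a \<in> carrier ?S" and b: "b \<in> carrier ?S"
    show "?g (a + b) = ?g a + ?g b" "?g (a * b) = ?g a * ?g b"
      by (rule eqI; simp add: h g[OF a] g[OF b] carrier_generated_closed)+
  qed (rule g)
qed

section \<open>Lattice points and faces of 0/1 polytopes\<close>

lemma lookup_scaleR:
  fixes x :: "'a \<Rightarrow>\<^sub>0 'b::real_vector"
  shows "Poly_Mapping.lookup (r *\<^sub>R x) i = r *\<^sub>R Poly_Mapping.lookup x i"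
proof -
  have "finite {i. r *\<^sub>R Poly_Mapping.lookup x i \<noteq> 0}"
    by (rule finite_subset[of _ "Poly_Mapping.keys x"]) (auto simp: in_keys_iff)
  then show ?thesis by (simp add: scaleR_poly_mapping_def)
qed

text \<open>Polymorphic in the values: over the reals these are the cut vectors, over the naturals
  the corresponding exponent vectors.\<close>

definition indic :: "'e set \<Rightarrow> ('e \<Rightarrow>\<^sub>0 'a::semiring_1)" where
  "indic D = (\<Sum>e\<in>D. Poly_Mapping.single e 1)"

lemma lookup_indic: "finite D \<Longrightarrow> Poly_Mapping.lookup (indic D) e = (if e \<in> D then 1 else 0)"
  by (simp add: indic_def lookup_sum lookup_single when_def)

lemma keys_indic: "finite D \<Longrightarrow> Poly_Mapping.keys (indic D :: 'e \<Rightarrow>\<^sub>0 'a::semiring_1) = D"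
  by (auto simp: in_keys_iff lookup_indic split: if_splits)

lemma lookup_map_real: "Poly_Mapping.lookup (Poly_Mapping.map real a) e = real (Poly_Mapping.lookup a e)"
  by (simp add: Poly_Mapping.map.rep_eq when_def)

lemma map_real_indic: "finite D \<Longrightarrow> Poly_Mapping.map real (indic D) = indic D"
  by (rule poly_mapping_eqI) (simp add: lookup_map_real lookup_indic)

text \<open>In a convex combination of 0/1 vectors, any vertex of positive weight agrees with the
  point wherever the point has coordinate 0 or 1. The proof avoids explicit weights: the points
  admitting such a vertex form a convex set containing all vertices.\<close>

lemma convex_hull_indic_rounding:
  assumes fin: "\<And>D. D \<in> \<D> \<Longrightarrow> finite D"
    and x: "x \<in> convex hull (indic ` \<D>)"
  shows "\<exists>D\<in>\<D>. \<forall>e. 0 \<le> Poly_Mapping.lookup x e \<and> Poly_Mapping.lookup x e \<le> (1::real) \<and>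
    (Poly_Mapping.lookup x e = 0 \<longrightarrow> e \<notin> D) \<and> (Poly_Mapping.lookup x e = 1 \<longrightarrow> e \<in> D)"
proof -
  let ?R = "\<lambda>x D. \<forall>e. 0 \<le> Poly_Mapping.lookup x e \<and> Poly_Mapping.lookup x e \<le> (1::real) \<and>
    (Poly_Mapping.lookup x e = 0 \<longrightarrow> e \<notin> D) \<and> (Poly_Mapping.lookup x e = 1 \<longrightarrow> e \<in> D)"
  have "convex {x. \<exists>D\<in>\<D>. ?R x D}"
    unfolding convex_alt
  proof (intro ballI allI impI)
    fix x y and t :: real
    assume "x \<in> {x. \<exists>D\<in>\<D>. ?R x D}" "y \<in> {x. \<exists>D\<in>\<D>. ?R x D}" and t: "0 \<le> t \<and> t \<le> 1"
    then obtain D D' where D: "D \<in> \<D>" "?R x D" and D': "D' \<in> \<D>" "?R y D'" by auto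
    show "(1 - t) *\<^sub>R x + t *\<^sub>R y \<in> {x. \<exists>D\<in>\<D>. ?R x D}"
    \<comment> \<open>For \<open>t = 0\<close> the point is \<open>x\<close> and keeps
      \<open>D\<close>; otherwise \<open>y\<close> has positive weight and its set \<open>D'\<close>
      serves.\<close>
    proof (cases "t = 0")
      case True
      then show ?thesis using D by auto
    next
      case False
      have "?R ((1 - t) *\<^sub>R x + t *\<^sub>R y) D'"
      proof
        fix e
        define a b where "a = Poly_Mapping.lookup x e" and "b = Poly_Mapping.lookup y e"
        have ab: "0 \<le> a" "a \<le> 1" "0 \<le> b" "b \<le> 1" and b: "b = 0 \<longrightarrow> e \<notin> D'" "b = 1 \<longrightarrow> e \<in> D'"
          using D(2) D'(2) by (auto simp: a_def b_def)
        have pos: "0 \<le> (1 - t) * a" "0 \<le> t * b" "0 \<le> (1 - t) * (1 - a)" "0 \<le> t * (1 - b)"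
          using ab t by simp_all
        \<comment> \<open>All four summands are nonnegative. If the first two already give 1, the
          others vanish, whence \<open>b = 1\<close> as t is nonzero.\<close>
        have one: "(1 - t) * a + t * b + (1 - t) * (1 - a) + t * (1 - b) = 1"
          by (simp add: algebra_simps)
        have "t * b = 0" if "(1 - t) * a + t * b = 0" using that pos by linarith
        moreover have "t * (1 - b) = 0" if "(1 - t) * a + t * b = 1"
          using that pos one by linarith
        moreover have "(1 - t) * a + t * b \<le> 1"
          using pos one by linarith
        ultimately show "0 \<le> Poly_Mapping.lookup ((1 - t) *\<^sub>R x + t *\<^sub>R y) e \<and>
            Poly_Mapping.lookup ((1 - t) *\<^sub>R x + t *\<^sub>R y) e \<le> 1 \<and>
            (Poly_Mapping.lookup ((1 - t) *\<^sub>R x + t *\<^sub>R y) e = 0 \<longrightarrow> e \<notin> D') \<and>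
            (Poly_Mapping.lookup ((1 - t) *\<^sub>R x + t *\<^sub>R y) e = 1 \<longrightarrow> e \<in> D')"
          using b pos False by (simp add: lookup_add lookup_scaleR flip: a_def b_def)
      qed
      then show ?thesis using D'(1) by blast
    qed
  qed
  moreover have "indic ` \<D> \<subseteq> {x. \<exists>D\<in>\<D>. ?R x D}"
  proof clarify
    fix D assume D: "D \<in> \<D>"
    then have "?R (indic D) D" using fin[OF D] by (simp add: lookup_indic)
    then show "\<exists>D'\<in>\<D>. ?R (indic D) D'" using D by blast
  qed
  ultimately have "convex hull (indic ` \<D>) \<subseteq> {x. \<exists>D\<in>\<D>. ?R x D}"
    by (intro hull_minimal)
  then show ?thesis using x by blast
qed

text \<open>A lattice point of the hull has all coordinates in {0, 1}, so the vertex provided by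
  rounding agrees with it everywhere.\<close>

lemma lattice_points_hull_indic:
  assumes fin: "\<And>D. D \<in> \<D> \<Longrightarrow> finite D"
  shows "lattice_points (convex hull (indic ` \<D>)) = indic ` \<D>"
proof
  show "indic ` \<D> \<subseteq> lattice_points (convex hull (indic ` \<D>))"
    using fin by (auto simp: lattice_points_def map_real_indic intro: hull_inc)
  show "lattice_points (convex hull (indic ` \<D>)) \<subseteq> indic ` \<D>"
  proof
    fix a assume "a \<in> lattice_points (convex hull (indic ` \<D>))"
    then have "Poly_Mapping.map real a \<in> convex hull (indic ` \<D>)"
      by (simp add: lattice_points_def)
    from convex_hull_indic_rounding[OF fin this] obtain D where D: "D \<in> \<D>"
      and *: "\<And>e. real (Poly_Mapping.lookup a e) \<le> 1 \<and> (real (Poly_Mapping.lookup a e) = 0 \<longrightarrow> e \<notin> D)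
        \<and> (real (Poly_Mapping.lookup a e) = 1 \<longrightarrow> e \<in> D)"
      unfolding lookup_map_real by blast
    have "a = indic D"
    proof (rule poly_mapping_eqI)
      fix e
      have "Poly_Mapping.lookup a e = 0 \<or> Poly_Mapping.lookup a e = 1"
        using *[of e] by auto
      then show "Poly_Mapping.lookup a e = Poly_Mapping.lookup (indic D) e"
        using *[of e] fin[OF D] by (auto simp: lookup_indic)
    qed
    then show "a \<in> indic ` \<D>" using D by blast
  qed
qed

text \<open>The hyperplane is supporting: if a combination of two nonnegative numbers with positive
  weights is zero, both numbers are zero.\<close>

lemma coordinate_face:
  assumes "convex P" and nonneg: "\<And>x. x \<in> P \<Longrightarrow> 0 \<le> Poly_Mapping.lookup x e"
  shows "{x \<in> P. Poly_Mapping.lookup x e = (0::real)} face_of P"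
  unfolding face_of_def
proof (intro conjI ballI impI)
  show "convex {x \<in> P. Poly_Mapping.lookup x e = (0::real)}"
    using assms(1) by (auto simp: convex_def lookup_add lookup_scaleR)
next
  fix a b x assume ab: "a \<in> P" "b \<in> P" and x: "x \<in> {x \<in> P. Poly_Mapping.lookup x e = 0}"
    and "x \<in> open_segment a b"
  then obtain t where t: "0 < t" "t < 1" and "x = (1 - t) *\<^sub>R a + t *\<^sub>R b"
    unfolding in_segment by blast
  then have "(1 - t) * Poly_Mapping.lookup a e + t * Poly_Mapping.lookup b e = 0"
    using x by (simp add: lookup_add lookup_scaleR)
  moreover have "0 \<le> (1 - t) * Poly_Mapping.lookup a e" "0 \<le> t * Poly_Mapping.lookup b e"
    using nonneg[OF ab(1)] nonneg[OF ab(2)] t by simp_all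
  ultimately have "(1 - t) * Poly_Mapping.lookup a e = 0" "t * Poly_Mapping.lookup b e = 0"
    by linarith+
  then show "a \<in> {x \<in> P. Poly_Mapping.lookup x e = 0}" "b \<in> {x \<in> P. Poly_Mapping.lookup x e = 0}"
    using ab t by simp_all
qed auto

section \<open>Cuts and contraction\<close>

text \<open>The cut described by one side only, as in \<open>cut_vector\<close>. It links the
  partitions indexing cut monomials to the vertex sets indexing cut vectors.\<close>

definition crossing :: "'v graph \<Rightarrow> 'v set \<Rightarrow> 'v set set" where
  "crossing G A = {e \<in> edges G. card (A \<inter> e) = 1}"

lemma card_Int_doubleton:
  assumes "a \<noteq> b"
  shows "card (A \<inter> {a, b}) = 1 \<longleftrightarrow> (a \<in> A) \<noteq> (b \<in> A)"
  using assms by (simp add: Int_insert_right)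

lemma simple_graph_finite_edges: "simple_graph G \<Longrightarrow> finite (edges G)"
  by (rule finite_subset[of _ "Pow (verts G)"]) (auto simp: simple_graph_def)

lemma simple_graph_edgeE:
  assumes "simple_graph G" "e \<in> edges G"
  obtains a b where "e = {a, b}" "a \<noteq> b" "a \<in> verts G" "b \<in> verts G"
proof -
  have "card e = 2" "e \<subseteq> verts G" using assms by (auto simp: simple_graph_def)
  then show ?thesis using that unfolding card_2_iff by blast
qed

lemma Cut_eq_crossing:
  assumes G: "simple_graph G" and AB: "A \<union> B = verts G" "A \<inter> B = {}"
  shows "Cut G {A, B} = crossing G A"
proof (rule set_eqI)
  fix e
  show "e \<in> Cut G {A, B} \<longleftrightarrow> e \<in> crossing G A"
  proof (cases "e \<in> edges G")
    case True
    obtain a b where e: "e = {a, b}" "a \<noteq> b" "a \<in> verts G" "b \<in> verts G"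
      by (rule simple_graph_edgeE[OF G True])
    \<comment> \<open>Reading the unordered pair of parts in the opposite order is absorbed by
      exchanging \<open>i\<close> and \<open>j\<close>.\<close>
    have "(\<exists>A' B' i j. {A, B} = {A', B'} \<and> e = {i, j} \<and> i \<in> A' \<and> j \<in> B')
        \<longleftrightarrow> (\<exists>i j. e = {i, j} \<and> i \<in> A \<and> j \<in> B)"
      by (metis doubleton_eq_iff)
    also have "\<dots> \<longleftrightarrow> (a \<in> A \<and> b \<in> B) \<or> (b \<in> A \<and> a \<in> B)"
      unfolding e(1) by (metis doubleton_eq_iff)
    also have "\<dots> \<longleftrightarrow> (a \<in> A) \<noteq> (b \<in> A)"
      using AB e(3,4) by blast
    also have "\<dots> \<longleftrightarrow> card (A \<inter> e) = 1"
      unfolding e(1) card_Int_doubleton[OF e(2)] ..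
    finally show ?thesis using True by (simp add: Cut_def crossing_def)
  qed (simp add: Cut_def crossing_def)
qed

lemma Cut_image_partitions:
  assumes "simple_graph G"
  shows "Cut G ` partitions (verts G) = crossing G ` Pow (verts G)"
proof
  show "Cut G ` partitions (verts G) \<subseteq> crossing G ` Pow (verts G)"
    using Cut_eq_crossing[OF assms] by (auto simp: partitions_def)
  show "crossing G ` Pow (verts G) \<subseteq> Cut G ` partitions (verts G)"
  proof (rule image_subsetI)
    fix A assume A: "A \<in> Pow (verts G)"
    then have "{A, verts G - A} \<in> partitions (verts G)" unfolding partitions_def by blast
    moreover have "Cut G {A, verts G - A} = crossing G A"
      using A by (intro Cut_eq_crossing[OF assms]) auto
    ultimately show "crossing G A \<in> Cut G ` partitions (verts G)" by force
  qed
qed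

lemma cut_polytope_eq: "cut_polytope G = convex hull (indic ` crossing G ` Pow (verts G))"
proof -
  have "{cut_vector G A | A. A \<subseteq> verts G} = indic ` crossing G ` Pow (verts G)"
    by (auto simp: cut_vector_def indic_def crossing_def image_image)
  then show ?thesis by (simp add: cut_polytope_def)
qed

section \<open>The vertex map of the contraction and pullback of cuts\<close>

definition glue :: "'v \<Rightarrow> 'v \<Rightarrow> 'v \<Rightarrow> 'v \<Rightarrow> 'v" where
  "glue u v w x = (if x = u \<or> x = v then w else x)"

context
  fixes G :: "'v graph" and u v w :: 'v
  assumes G: "simple_graph G" and uv: "{u, v} \<in> edges G" and w: "w \<notin> verts G"
begin

text \<open>Since \<open>w\<close> is not a vertex of \<open>G\<close>, the only identification made
  is that of \<open>u\<close> with \<open>v\<close>.\<close>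

lemma glue_inj:
  assumes "a \<in> verts G" "b \<in> verts G" "glue u v w a = glue u v w b"
  shows "a = b \<or> {a, b} \<subseteq> {u, v}"
proof -
  have "a \<noteq> w" "b \<noteq> w" using assms w by blast+
  then show ?thesis using assms(3) unfolding glue_def by (metis insert_subset empty_subsetI insertI1 insertI2)
qed

lemma uv_verts: "u \<noteq> v" "u \<in> verts G" "v \<in> verts G"
proof -
  have *: "card {u, v} = 2" "{u, v} \<subseteq> verts G" using G uv unfolding simple_graph_def by blast+
  then show "u \<noteq> v" "u \<in> verts G" "v \<in> verts G" by auto
qed

lemma verts_contract: "verts (contract G u v w) = glue u v w ` verts G"
  using uv_verts by (auto simp: contract_def glue_def)

text \<open>An edge other than the contracted one does not collapse to a loop, because
  \<open>G\<close> has no second edge on \<open>u\<close> and \<open>v\<close>.\<close>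

lemma edge_cases:
  assumes "d \<in> edges G - {{u, v}}"
  obtains a b where "d = {a, b}" "a \<noteq> b" "a \<in> verts G" "b \<in> verts G"
    "glue u v w a \<noteq> glue u v w b"
proof -
  obtain a b where ab: "d = {a, b}" "a \<noteq> b" "a \<in> verts G" "b \<in> verts G"
    using simple_graph_edgeE[OF G, of d] assms by auto
  moreover have "glue u v w a \<noteq> glue u v w b"
    using glue_inj[OF ab(3,4)] ab(1,2) assms by auto
  ultimately show ?thesis by (rule that)
qed

text \<open>Taking the image as a set merges the parallel edges that arise when some
  \<open>z\<close> is adjacent to both \<open>u\<close> and \<open>v\<close>.\<close>

lemma edges_contract: "edges (contract G u v w) = image (glue u v w) ` (edges G - {{u, v}})"
proof
  show "edges (contract G u v w) \<subseteq> image (glue u v w) ` (edges G - {{u, v}})"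
  proof
    fix f assume "f \<in> edges (contract G u v w)"
    then consider "f \<in> edges G" "f \<inter> {u, v} = {}"
      | z where "f = {w, z}" "z \<in> verts G - {u, v}" "{z, u} \<in> edges G \<or> {z, v} \<in> edges G"
      unfolding contract_def by auto
    then show "f \<in> image (glue u v w) ` (edges G - {{u, v}})"
    proof cases
      case 1
      then have "glue u v w ` f = f" by (force simp: glue_def)
      then show ?thesis using 1 by (intro image_eqI[of _ _ f]) auto
    next
      case 2
      then obtain x where x: "{z, x} \<in> edges G" "x \<in> {u, v}" by blast
      then have "glue u v w ` {z, x} = f" using 2 by (auto simp: glue_def)
      then show ?thesis using x 2(2) by (intro image_eqI[of _ _ "{z, x}"]) auto
    qed
  qed
  show "image (glue u v w) ` (edges G - {{u, v}}) \<subseteq> edges (contract G u v w)"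
  proof (rule image_subsetI)
    fix d assume d: "d \<in> edges G - {{u, v}}"
    then obtain a b where ab: "d = {a, b}" "a \<noteq> b" "a \<in> verts G" "b \<in> verts G"
      "glue u v w a \<noteq> glue u v w b" by (rule edge_cases)
    have *: "glue u v w ` {a, b} \<in> edges (contract G u v w)"
      if "a \<in> {u, v}" "b \<notin> {u, v}" "{a, b} \<in> edges G" "b \<in> verts G" for a b
    proof -
      have "glue u v w ` {a, b} = {w, b}" using that by (auto simp: glue_def)
      moreover have "{b, u} \<in> edges G \<or> {b, v} \<in> edges G"
        using that by (auto simp: insert_commute)
      ultimately show ?thesis using that unfolding contract_def by auto
    qed
    \<comment> \<open>Both ends cannot lie in {u, v}, since they would then be glued
      together.\<close>
    consider "a \<in> {u, v}" "b \<notin> {u, v}" | "b \<in> {u, v}" "a \<notin> {u, v}" | "a \<notin> {u, v}" "b \<notin> {u, v}"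
      using ab(5) unfolding glue_def by fastforce
    then show "glue u v w ` d \<in> edges (contract G u v w)"
    proof cases
      case 1
      then show ?thesis using *[of a b] d ab by simp
    next
      case 2
      then show ?thesis using *[of b a] d ab by (simp add: insert_commute)
    next
      case 3
      then have "glue u v w ` d = d" "d \<inter> {u, v} = {}" using ab(1) by (auto simp: glue_def)
      then show ?thesis using d by (simp add: contract_def)
    qed
  qed
qed

lemma simple_graph_contract: "simple_graph (contract G u v w)"
  unfolding simple_graph_def verts_contract edges_contract
proof (intro conjI ballI)
  show "finite (glue u v w ` verts G)" "glue u v w ` verts G \<noteq> {}"
    using G by (auto simp: simple_graph_def)
next
  fix f assume "f \<in> image (glue u v w) ` (edges G - {{u, v}})"
  then obtain d where d: "d \<in> edges G - {{u, v}}" "f = glue u v w ` d" by blast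
  obtain a b where "d = {a, b}" "a \<in> verts G" "b \<in> verts G" "glue u v w a \<noteq> glue u v w b"
    using d(1) by (rule edge_cases)
  then show "f \<subseteq> glue u v w ` verts G" "card f = 2"
    unfolding d(2) by simp_all
qed

text \<open>\<open>A\<close> is the preimage of \<open>A'\<close> under gluing, so an endpoint lies
  in \<open>A\<close> exactly when its glued image lies in \<open>A'\<close>; in particular
  \<open>u\<close> and \<open>v\<close> are on the same side.\<close>

lemma crossing_contract:
  assumes "A' \<subseteq> glue u v w ` verts G"
  defines "A \<equiv> {x \<in> verts G. glue u v w x \<in> A'}"
  shows "{d \<in> edges G - {{u, v}}. glue u v w ` d \<in> crossing (contract G u v w) A'} = crossing G A"
    and "{u, v} \<notin> crossing G A"
proof -
  have uvA: "u \<in> A \<longleftrightarrow> v \<in> A" using uv_verts by (simp add: A_def glue_def)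
  then show uv_notin: "{u, v} \<notin> crossing G A"
    using card_Int_doubleton[OF uv_verts(1), of A] by (simp add: crossing_def)
  have "card (A' \<inter> glue u v w ` d) = 1 \<longleftrightarrow> card (A \<inter> d) = 1" if d: "d \<in> edges G - {{u, v}}" for d
  proof -
    obtain a b where ab: "d = {a, b}" "a \<noteq> b" "a \<in> verts G" "b \<in> verts G"
      "glue u v w a \<noteq> glue u v w b" using d by (rule edge_cases)
    show ?thesis
      unfolding ab(1) image_insert image_empty card_Int_doubleton[OF ab(2)] card_Int_doubleton[OF ab(5)]
      using ab(3,4) by (simp add: A_def)
  qed
  then show "{d \<in> edges G - {{u, v}}. glue u v w ` d \<in> crossing (contract G u v w) A'} = crossing G A"
    using uv_notin by (auto simp: crossing_def edges_contract)
qed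

text \<open>A vertex set that does not separate \<open>u\<close> from \<open>v\<close> is a union of
  fibres of the gluing map, hence the preimage of its own image.\<close>

lemma contract_crossings:
  "(\<lambda>A'. {d \<in> edges G - {{u, v}}. glue u v w ` d \<in> crossing (contract G u v w) A'})
      ` Pow (verts (contract G u v w)) = {D \<in> crossing G ` Pow (verts G). {u, v} \<notin> D}"
  (is "?f ` _ = ?S")
  unfolding verts_contract
proof
  show "?f ` Pow (glue u v w ` verts G) \<subseteq> ?S"
    using crossing_contract by auto
  show "?S \<subseteq> ?f ` Pow (glue u v w ` verts G)"
  proof
    fix D assume "D \<in> ?S"
    then obtain A where A: "A \<subseteq> verts G" "D = crossing G A" "{u, v} \<notin> crossing G A" by auto
    then have uvA: "u \<in> A \<longleftrightarrow> v \<in> A"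
      using card_Int_doubleton[OF uv_verts(1), of A] uv by (auto simp: crossing_def)
    have "x \<in> A" if x: "x \<in> verts G" and eq: "glue u v w x = glue u v w y" and y: "y \<in> A" for x y
      using glue_inj[OF x _ eq] y A(1) uvA by auto
    then have "{x \<in> verts G. glue u v w x \<in> glue u v w ` A} = A"
      using A(1) by auto
    then have "?f (glue u v w ` A) = D"
      using crossing_contract(1)[of "glue u v w ` A"] A by (simp add: image_mono)
    then show "D \<in> ?f ` Pow (glue u v w ` verts G)"
      using A(1) by (intro image_eqI[of _ _ "glue u v w ` A"]) auto
  qed
qed

end

section \<open>Cut algebras as polytopal algebras\<close>

text \<open>A product of \<open>n\<close> cut monomials uses \<open>n\<close> factors s or t at
  every edge, so its exponent vector satisfies this condition with that \<open>n\<close>.\<close>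

definition balanced :: "'e set \<Rightarrow> ('e stvar \<Rightarrow>\<^sub>0 nat) set" where
  "balanced E = {m. Poly_Mapping.keys m \<subseteq> SV ` E \<union> TV ` E \<and>
     (\<exists>n. \<forall>e\<in>E. Poly_Mapping.lookup m (SV e) + Poly_Mapping.lookup m (TV e) = n)}"

lemma submonoid_balanced: "submonoid (balanced E)"
  unfolding submonoid_def
proof (intro conjI ballI)
  show "0 \<in> balanced E" by (simp add: balanced_def)
  fix a b assume a: "a \<in> balanced E" and b: "b \<in> balanced E"
  from a b obtain i j where
    "\<forall>e\<in>E. Poly_Mapping.lookup a (SV e) + Poly_Mapping.lookup a (TV e) = i"
    "\<forall>e\<in>E. Poly_Mapping.lookup b (SV e) + Poly_Mapping.lookup b (TV e) = j"
    unfolding balanced_def by blast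
  then have "\<forall>e\<in>E. Poly_Mapping.lookup (a + b) (SV e) + Poly_Mapping.lookup (a + b) (TV e) = i + j"
    by (auto simp: lookup_add)
  moreover have "Poly_Mapping.keys (a + b) \<subseteq> SV ` E \<union> TV ` E"
    using keys_add[of a b] a b unfolding balanced_def by blast
  ultimately show "a + b \<in> balanced E" unfolding balanced_def by blast
qed

lemma Cut_subset: "Cut G p \<subseteq> edges G"
  by (auto simp: Cut_def)

text \<open>\<open>?m\<close> is the exponent vector of the cut monomial: each edge contributes
  exactly one of its two variables, so the common sum is 1.\<close>

lemma keys_cut_monomial:
  assumes fin: "finite (edges G)"
  shows "Poly_Mapping.keys (cut_monomial G p :: ('v set stvar, 'k::field) mpoly) \<subseteq> balanced (edges G)"
proof -
  let ?m = "(\<Sum>e\<in>Cut G p. Poly_Mapping.single (SV e) 1) + (\<Sum>e\<in>edges G - Cut G p. Poly_Mapping.single (TV e) 1)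
    :: 'v set stvar \<Rightarrow>\<^sub>0 nat"
  have [simp]: "finite (Cut G p)" by (rule finite_subset[OF Cut_subset fin])
  have S: "Poly_Mapping.lookup ?m (SV e) = (if e \<in> Cut G p then 1 else 0)" for e
    by (simp add: lookup_add lookup_sum lookup_single when_def)
  have T: "Poly_Mapping.lookup ?m (TV e) = (if e \<in> edges G - Cut G p then 1 else 0)" for e
    using fin by (simp add: lookup_add lookup_sum lookup_single when_def)
  have "x \<in> SV ` edges G \<union> TV ` edges G" if "x \<in> Poly_Mapping.keys ?m" for x
  proof (cases x)
    case (SV e)
    then have "e \<in> Cut G p" using that S[of e] unfolding in_keys_iff by (metis (no_types))
    then show ?thesis using Cut_subset SV by blast
  next
    case (TV e)
    then have "e \<in> edges G - Cut G p" using that T[of e] unfolding in_keys_iff by (metis (no_types))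
    then show ?thesis using TV by blast
  qed
  moreover have "\<forall>e\<in>edges G. Poly_Mapping.lookup ?m (SV e) + Poly_Mapping.lookup ?m (TV e) = 1"
    unfolding S T by simp
  ultimately have "?m \<in> balanced (edges G)"
    unfolding balanced_def by blast
  then show ?thesis
    by (simp add: cut_monomial_def var_def prod_single mult_single)
qed

text \<open>\<open>E0\<close> indexes the y variables and \<open>c\<close> sends them to the edges
  of the graph at hand. The identity gives the natural map for \<open>G\<close>, the gluing of edges
  the map for \<open>G'\<close>; \<open>e0\<close> is the edge that carries z.\<close>

definition cut_exponent :: "'e set \<Rightarrow> ('e \<Rightarrow> 'e) \<Rightarrow> 'e \<Rightarrow> 'e stvar \<Rightarrow> ('e yzvar \<Rightarrow>\<^sub>0 nat)" where
  "cut_exponent E0 c e0 x =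
     (case x of SV e \<Rightarrow> (\<Sum>d\<in>{d \<in> E0. c d = e}. Poly_Mapping.single (YV d) 1) +
                        (if e = e0 then Poly_Mapping.single ZV 1 else 0)
              | TV e \<Rightarrow> if e = e0 then Poly_Mapping.single ZV 1 else 0)"

definition cut_hom :: "'e set \<Rightarrow> ('e \<Rightarrow> 'e) \<Rightarrow> 'e \<Rightarrow> ('e stvar, 'k::field) mpoly \<Rightarrow> ('e yzvar, 'k) mpoly" where
  "cut_hom E0 c e0 = subst (\<lambda>x. Poly_Mapping.single (cut_exponent E0 c e0 x) 1)"

lemma sum_stvar:
  assumes "finite E"
  shows "(\<Sum>x\<in>SV ` E \<union> TV ` E. g x) = (\<Sum>e\<in>E. g (SV e)) + (\<Sum>e\<in>E. g (TV e))"
proof -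
  have "(\<Sum>x\<in>SV ` E \<union> TV ` E. g x) = (\<Sum>x\<in>SV ` E. g x) + (\<Sum>x\<in>TV ` E. g x)"
    using assms by (intro sum.union_disjoint) auto
  then show ?thesis by (simp add: sum.reindex inj_on_def)
qed

text \<open>The y exponents recover all s exponents, as \<open>c\<close> is onto \<open>E\<close>.
  The z exponent is the common sum of s and t exponents, so the t exponents follow by
  subtraction.\<close>

lemma cut_exponent_inj_on:
  assumes fin: "finite E" "finite E0" and c: "c ` E0 = E" and e0: "e0 \<in> E"
  shows "inj_on (monomial_map (cut_exponent E0 c e0)) (balanced E)"
proof (rule inj_onI)
  fix m m' assume m: "m \<in> balanced E" and m': "m' \<in> balanced E"
    and eq: "monomial_map (cut_exponent E0 c e0) m = monomial_map (cut_exponent E0 c e0) m'"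
  have Y: "Poly_Mapping.lookup (monomial_map (cut_exponent E0 c e0) m) (YV d) = Poly_Mapping.lookup m (SV (c d))"
    if "m \<in> balanced E" and d: "d \<in> E0" for m d
  proof -
    have 1: "Poly_Mapping.lookup (cut_exponent E0 c e0 (SV e)) (YV d) = (if c d = e then 1 else 0)" for e
      using fin d by (simp add: cut_exponent_def lookup_add lookup_sum lookup_single when_def)
    have 2: "Poly_Mapping.lookup (cut_exponent E0 c e0 (TV e)) (YV d) = 0" for e
      by (simp add: cut_exponent_def lookup_single when_def)
    have "c d \<in> E" using c d by blast
    moreover have "Poly_Mapping.keys m \<subseteq> SV ` E \<union> TV ` E" using that by (simp add: balanced_def)
    ultimately show ?thesis
      using fin by (simp add: lookup_monomial_map[of "SV ` E \<union> TV ` E"] sum_stvar 1 2 if_distrib[of "(*) _"] cong: if_cong)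
  qed
  have Z: "Poly_Mapping.lookup (monomial_map (cut_exponent E0 c e0) m) ZV
      = Poly_Mapping.lookup m (SV e0) + Poly_Mapping.lookup m (TV e0)"
    if "m \<in> balanced E" for m
  proof -
    have 1: "Poly_Mapping.lookup (cut_exponent E0 c e0 (SV e)) ZV = (if e = e0 then 1 else 0)" for e
      by (simp add: cut_exponent_def lookup_add lookup_sum lookup_single when_def)
    have 2: "Poly_Mapping.lookup (cut_exponent E0 c e0 (TV e)) ZV = (if e = e0 then 1 else 0)" for e
      by (simp add: cut_exponent_def lookup_single when_def)
    have "Poly_Mapping.keys m \<subseteq> SV ` E \<union> TV ` E" using that by (simp add: balanced_def)
    then show ?thesis
      using fin e0 by (simp add: lookup_monomial_map[of "SV ` E \<union> TV ` E"] sum_stvar 1 2 if_distrib[of "(*) _"] cong: if_cong)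
  qed
  have S: "Poly_Mapping.lookup m (SV e) = Poly_Mapping.lookup m' (SV e)" if e: "e \<in> E" for e
  proof -
    obtain d where "d \<in> E0" "e = c d" using c e by blast
    then show ?thesis using Y[OF m] Y[OF m'] eq by metis
  qed
  have T: "Poly_Mapping.lookup m (TV e) = Poly_Mapping.lookup m' (TV e)" if "e \<in> E" for e
  proof -
    \<comment> \<open>Balancedness carries the sum, visible in z only at \<open>e0\<close>, over to
      the edge \<open>e\<close>.\<close>
    have "Poly_Mapping.lookup m (SV e) + Poly_Mapping.lookup m (TV e)
        = Poly_Mapping.lookup m (SV e0) + Poly_Mapping.lookup m (TV e0)"
      using m that e0 unfolding balanced_def by force
    moreover have "Poly_Mapping.lookup m' (SV e) + Poly_Mapping.lookup m' (TV e)
        = Poly_Mapping.lookup m' (SV e0) + Poly_Mapping.lookup m' (TV e0)"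
      using m' that e0 unfolding balanced_def by force
    ultimately show ?thesis using Z[OF m] Z[OF m'] eq S[OF that] by simp
  qed
  show "m = m'"
  proof (rule poly_mapping_eqI)
    fix x
    show "Poly_Mapping.lookup m x = Poly_Mapping.lookup m' x"
    proof (cases "x \<in> SV ` E \<union> TV ` E")
      case True
      then show ?thesis using S T by blast
    next
      case False
      then have "x \<notin> Poly_Mapping.keys m" "x \<notin> Poly_Mapping.keys m'"
        using m m' unfolding balanced_def by blast+
      then show ?thesis by (simp add: in_keys_iff)
    qed
  qed
qed

lemma cut_hom_cut_monomial:
  assumes fin: "finite (edges H)" "finite E0" and e0: "e0 \<in> edges H"
  shows "cut_hom E0 c e0 (cut_monomial H p) = var ZV * (\<Prod>d\<in>{d \<in> E0. c d \<in> Cut H p}. var (YV d))"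
proof -
  have Cut_fin: "finite (Cut H p)" by (rule finite_subset[OF Cut_subset fin(1)])
  \<comment> \<open>The fibres of \<open>c\<close> over the edges of the cut partition the
    pulled-back cut.\<close>
  have "(\<Sum>e\<in>Cut H p. \<Sum>d\<in>{d \<in> E0. c d = e}. Poly_Mapping.single (YV d) 1)
      = (\<Sum>e\<in>Cut H p. \<Sum>d\<in>{d \<in> {d \<in> E0. c d \<in> Cut H p}. c d = e}. Poly_Mapping.single (YV d) (1::nat))"
    by (intro sum.cong) auto
  also have "\<dots> = (\<Sum>d\<in>{d \<in> E0. c d \<in> Cut H p}. Poly_Mapping.single (YV d) 1)"
    by (rule sum.group) (use fin Cut_fin in auto)
  finally have 1: "(\<Sum>e\<in>Cut H p. \<Sum>d\<in>{d \<in> E0. c d = e}. Poly_Mapping.single (YV d) (1::nat))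
      = (\<Sum>d\<in>{d \<in> E0. c d \<in> Cut H p}. Poly_Mapping.single (YV d) 1)" .
  \<comment> \<open>\<open>e0\<close> lies either in the cut or in its complement, so z occurs
    exactly once.\<close>
  have 2: "(\<Sum>e\<in>Cut H p. if e = e0 then Poly_Mapping.single ZV 1 else 0)
      + (\<Sum>e\<in>edges H - Cut H p. if e = e0 then Poly_Mapping.single ZV 1 else 0)
      = Poly_Mapping.single ZV (1::nat)"
    using Cut_fin fin e0 by simp
  have "cut_hom E0 c e0 (cut_monomial H p)
      = Poly_Mapping.single ((\<Sum>e\<in>Cut H p. cut_exponent E0 c e0 (SV e))
          + (\<Sum>e\<in>edges H - Cut H p. cut_exponent E0 c e0 (TV e))) (1::'b)"
    by (simp add: cut_hom_def cut_monomial_def subst_mult subst_prod prod_single mult_single)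
  also have "(\<Sum>e\<in>Cut H p. cut_exponent E0 c e0 (SV e)) + (\<Sum>e\<in>edges H - Cut H p. cut_exponent E0 c e0 (TV e))
      = Poly_Mapping.single ZV 1 + (\<Sum>d\<in>{d \<in> E0. c d \<in> Cut H p}. Poly_Mapping.single (YV d) 1)"
    unfolding cut_exponent_def stvar.case sum.distrib 1 add.assoc 2 by (rule add.commute)
  finally show ?thesis
    by (simp add: var_def prod_single mult_single)
qed

lemma yz_monomial_indic:
  "finite D \<Longrightarrow> yz_monomial (indic D) = var ZV * (\<Prod>d\<in>D. var (YV d))"
  by (simp add: yz_monomial_def keys_indic lookup_indic mult.commute)

text \<open>Stated for a general \<open>c\<close> so that it yields both the isomorphism of the cut
  algebra of \<open>G\<close> with that of its polytope and the one of the cut algebra of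
  \<open>G'\<close> with that of the face.\<close>

lemma cut_algebra_iso:
  assumes H: "simple_graph H" and e0: "e0 \<in> edges H" and E0: "finite E0" and c: "c ` E0 = edges H"
    and Q: "lattice_points Q = indic ` (\<lambda>p. {d \<in> E0. c d \<in> Cut H p}) ` partitions (verts H)"
  shows "graded_iso (cut_algebra H) (polytopal_algebra Q :: ('v set yzvar, 'k::field) mpoly graded_algebra)
    (cut_hom E0 c e0)"
proof -
  note fin = simple_graph_finite_edges[OF H]
  have "cut_hom E0 c e0 (cut_monomial H p :: ('v set stvar, 'k) mpoly)
      = yz_monomial (indic {d \<in> E0. c d \<in> Cut H p})" for p
    using E0 by (simp add: cut_hom_cut_monomial[OF fin E0 e0] yz_monomial_indic)
  then have image: "(\<lambda>p. cut_hom E0 c e0 (cut_monomial H p :: ('v set stvar, 'k) mpoly)) ` partitions (verts H)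
      = yz_monomial ` lattice_points Q"
    by (simp add: Q image_image)
  show ?thesis
    unfolding cut_algebra_def polytopal_algebra_def cut_hom_def
    by (rule graded_iso_subst[OF submonoid_balanced keys_cut_monomial[OF fin]
          subst_monomial_inj_on[OF cut_exponent_inj_on[OF fin E0 c e0]] image[unfolded cut_hom_def]])
qed

section \<open>Face projections and face retracts\<close>

text \<open>Setting \<open>YV e\<close> to 0 kills precisely the generators whose lattice points
  have positive coordinate at \<open>e\<close>, that is, those off the face. Being a substitution,
  the projection is automatically well defined and multiplicative.\<close>

lemma coordinate_face_projection:
  fixes P :: "('e \<Rightarrow>\<^sub>0 real) set" and e :: 'e
  defines "F \<equiv> {x \<in> P. Poly_Mapping.lookup x e = 0}"
  shows "face_projection P F
    (subst (\<lambda>x. if x = YV e then 0 else var x) :: ('e yzvar, 'k::field) mpoly \<Rightarrow> ('e yzvar, 'k) mpoly)"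
proof -
  let ?\<pi> = "subst (\<lambda>x. if x = YV e then 0 else var x) :: ('e yzvar, 'k) mpoly \<Rightarrow> ('e yzvar, 'k) mpoly"
  have F: "a \<in> lattice_points F \<longleftrightarrow> a \<in> lattice_points P \<and> e \<notin> Poly_Mapping.keys a" for a
    by (simp add: lattice_points_def F_def lookup_map_real in_keys_iff)
  have \<pi>: "?\<pi> (yz_monomial a) = (if e \<in> Poly_Mapping.keys a then 0 else yz_monomial a)" for a
  proof (cases "e \<in> Poly_Mapping.keys a")
    case True
    then have "(\<Prod>x\<in>Poly_Mapping.keys a. (if YV x = YV e then 0 else var (YV x) :: ('e yzvar, 'k) mpoly)
        ^ Poly_Mapping.lookup a x) = 0"
      by (intro prod_zero bexI[of _ e]) (auto simp: in_keys_iff zero_power)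
    then show ?thesis
      using True by (simp add: yz_monomial_def subst_mult subst_prod subst_power del: yzvar.inject)
  next
    case False
    then have "(\<Prod>x\<in>Poly_Mapping.keys a. (if YV x = YV e then 0 else var (YV x) :: ('e yzvar, 'k) mpoly)
        ^ Poly_Mapping.lookup a x) = (\<Prod>x\<in>Poly_Mapping.keys a. var (YV x) ^ Poly_Mapping.lookup a x)"
      by (intro prod.cong) auto
    then show ?thesis
      using False by (simp add: yz_monomial_def subst_mult subst_prod subst_power del: yzvar.inject)
  qed
  have "graded_hom (polytopal_algebra P) (polytopal_algebra F) ?\<pi>"
    unfolding polytopal_algebra_def
    \<comment> \<open>The zero polynomial counts as homogeneous of degree 1, so it is an admissible
      lift for a killed generator.\<close>
    by (rule graded_hom_subst[where r = "\<lambda>a. if e \<in> Poly_Mapping.keys a then 0 else var a"])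
      (simp_all add: \<pi> F var_in_polys del: One_nat_def)
  moreover have "graded_hom (polytopal_algebra F) (polytopal_algebra P)
      (id :: ('e yzvar, 'k) mpoly \<Rightarrow> ('e yzvar, 'k) mpoly)"
  proof -
    have "polys (lattice_points F) \<subseteq> (polys (lattice_points P) :: ('e \<Rightarrow>\<^sub>0 nat, 'k) mpoly set)"
      using F unfolding polys_def by blast
    then show ?thesis
      unfolding graded_hom_def polytopal_algebra_def carrier_generated piece_generated id_apply by blast
  qed
  moreover have "?\<pi> (id a) = a" if a: "a \<in> carrier (polytopal_algebra F)" for a
  proof -
    obtain p where p: "p \<in> polys (lattice_points F)" "a = subst yz_monomial p"
      using a unfolding polytopal_algebra_def carrier_generated by blast
    show ?thesis
      unfolding p(2) id_apply subst_subst by (rule subst_cong[OF p(1)]) (simp add: \<pi> F)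
  qed
  ultimately show ?thesis
    unfolding face_projection_def algebra_retract_def using \<pi> F by simp
qed

text \<open>The inclusion and projection of the face are transported along \<Phi> and \<Psi>. Both
  algebras are required to be generated ones so that the inverse isomorphisms are graded
  homomorphisms.\<close>

lemma face_retractI:
  fixes R :: "('x, 'k::field) mpoly graded_algebra" and S :: "('y, 'k) mpoly graded_algebra"
    and \<pi> :: "('e yzvar, 'k) mpoly \<Rightarrow> ('e yzvar, 'k) mpoly"
  assumes R: "R = generated f I" and S: "S = generated g J"
    and F: "F face_of P" "face_projection P F \<pi>"
    and \<Psi>: "graded_iso R (polytopal_algebra F) \<Psi>" and \<Phi>: "graded_iso S (polytopal_algebra P) \<Phi>"
  shows "face_retract R S P \<Phi>"
proof -
  define \<iota> where "\<iota> = inv_into (carrier S) \<Phi> \<circ> \<Psi>"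
  define \<rho> where "\<rho> = inv_into (carrier R) \<Psi> \<circ> (\<pi> \<circ> \<Phi>)"
  have \<pi>: "graded_hom (polytopal_algebra F) (polytopal_algebra P) (id :: ('e yzvar, 'k) mpoly \<Rightarrow> _)"
    "graded_hom (polytopal_algebra P) (polytopal_algebra F) \<pi>"
    "\<And>a. a \<in> carrier (polytopal_algebra F) \<Longrightarrow> \<pi> a = a"
    using F(2) by (auto simp: face_projection_def algebra_retract_def)
  have homs: "graded_hom R (polytopal_algebra F) \<Psi>" "graded_hom S (polytopal_algebra P) \<Phi>"
    and bij: "bij_betw \<Psi> (carrier R) (carrier (polytopal_algebra F))"
      "bij_betw \<Phi> (carrier S) (carrier (polytopal_algebra P))"
    using \<Psi> \<Phi> by (auto simp: graded_iso_def)
  have inv\<Phi>: "graded_hom (polytopal_algebra P) S (inv_into (carrier S) \<Phi>)"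
    using \<Phi> unfolding S polytopal_algebra_def by (rule graded_hom_inv_into)
  have inv\<Psi>: "graded_hom (polytopal_algebra F) R (inv_into (carrier R) \<Psi>)"
    using \<Psi> unfolding R polytopal_algebra_def by (rule graded_hom_inv_into)
  have \<Psi>_in: "\<Psi> a \<in> carrier (polytopal_algebra F)" "\<Psi> a \<in> carrier (polytopal_algebra P)"
    if "a \<in> carrier R" for a
    using homs(1) \<pi>(1) that by (auto simp: graded_hom_def)
  have \<Phi>\<iota>: "\<Phi> (\<iota> a) = \<Psi> a" if "a \<in> carrier R" for a
    using bij_betw_inv_into_right[OF bij(2) \<Psi>_in(2)[OF that]] by (simp add: \<iota>_def)
  have \<Psi>\<rho>: "\<Psi> (\<rho> b) = \<pi> (\<Phi> b)" if "b \<in> carrier S" for b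
  proof -
    have "\<pi> (\<Phi> b) \<in> carrier (polytopal_algebra F)"
      using homs(2) \<pi>(2) that by (auto simp: graded_hom_def)
    from bij_betw_inv_into_right[OF bij(1) this] show ?thesis by (simp add: \<rho>_def)
  qed
  have "graded_hom R (polytopal_algebra P) \<Psi>"
    using graded_hom_comp[OF homs(1) \<pi>(1)] by simp
  then have "graded_hom R S \<iota>" unfolding \<iota>_def using inv\<Phi> by (rule graded_hom_comp)
  moreover have "graded_hom S R \<rho>"
    unfolding \<rho>_def by (rule graded_hom_comp[OF graded_hom_comp[OF homs(2) \<pi>(2)] inv\<Psi>])
  \<comment> \<open>\<Phi> after \<iota> is \<Psi>, and \<pi> fixes the algebra of the face, so
    applying the inverse of \<Psi> returns \<open>a\<close>.\<close>
  moreover have "\<rho> (\<iota> a) = a" if "a \<in> carrier R" for a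
    using bij_betw_inv_into_left[OF bij(1) that] \<Phi>\<iota>[OF that] \<pi>(3)[OF \<Psi>_in(1)[OF that]]
    by (simp add: \<rho>_def)
  ultimately have "algebra_retract R S \<iota> \<rho>" by (simp add: algebra_retract_def)
  then show ?thesis
    unfolding face_retract_def using F \<Psi> \<Phi>\<iota> \<Psi>\<rho> by blast
qed

theorem corollary4p6:
  fixes G G' :: "'v graph"
  assumes "simple_graph G"
    and "edge_contraction_of G' G"
    and "edges G' \<noteq> {}"
  shows "\<exists>\<Phi>. natural_cut_iso G \<Phi> \<and>
    face_retract (cut_algebra G' :: ('v set stvar, 'k::field) mpoly graded_algebra)
      (cut_algebra G) (cut_polytope G) \<Phi>"
proof -
  obtain u v w where uv: "{u, v} \<in> edges G" and w: "w \<notin> verts G" and G': "G' = contract G u v w"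
    using assms(2) unfolding edge_contraction_of_def by blast
  \<comment> \<open>This edge carries z in the map for \<open>G'\<close>; for \<open>G\<close> the
    contracted edge does.\<close>
  obtain e' where e': "e' \<in> edges G'" using assms(3) by blast
  note G = assms(1)
  note fin = simple_graph_finite_edges[OF G]
  have G'_simple: "simple_graph G'"
    unfolding G' by (rule simple_graph_contract[OF G uv w])
  let ?P = "cut_polytope G" and ?E = "edges G - {{u, v}}" and ?c = "image (glue u v w)"
  let ?\<D> = "crossing G ` Pow (verts G)"
  define F where "F = {x \<in> ?P. Poly_Mapping.lookup x {u, v} = 0}"
  have fin_D: "finite D" if "D \<in> ?\<D>" for D
    using that fin by (auto simp: crossing_def)
  have lattice_P: "lattice_points ?P = indic ` ?\<D>"
    unfolding cut_polytope_eq using fin_D by (rule lattice_points_hull_indic)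
  have lattice_F: "lattice_points F = indic ` {D \<in> ?\<D>. {u, v} \<notin> D}"
  proof -
    have "lattice_points F = {a \<in> lattice_points ?P. {u, v} \<notin> Poly_Mapping.keys a}"
      by (auto simp: lattice_points_def F_def lookup_map_real in_keys_iff)
    also have "\<dots> = indic ` {D \<in> ?\<D>. {u, v} \<notin> D}"
      unfolding lattice_P using keys_indic[OF fin_D] by blast
    finally show ?thesis .
  qed
  have "F face_of ?P"
    unfolding F_def
  proof (rule coordinate_face)
    show "convex ?P" by (simp add: cut_polytope_def)
    show "0 \<le> Poly_Mapping.lookup x {u, v}" if "x \<in> ?P" for x
      using convex_hull_indic_rounding[OF fin_D that[unfolded cut_polytope_eq]] by blast
  qed
  have "{d \<in> edges G. id d \<in> Cut G p} = Cut G p" for p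
    using Cut_subset[of G p] by auto
  then have "graded_iso (cut_algebra G) (polytopal_algebra ?P :: ('v set yzvar, 'k) mpoly graded_algebra)
      (cut_hom (edges G) id {u, v})"
    by (intro cut_algebra_iso[OF G uv fin]) (simp_all add: lattice_P Cut_image_partitions[OF G])
  note \<Phi> = this
  \<comment> \<open>The images of the cut monomials of \<open>G'\<close> are indexed by pulled-back
    cuts, which are shown to be the cuts giving the lattice points of \<open>F\<close>.\<close>
  have "(\<lambda>p. {d \<in> ?E. ?c d \<in> Cut G' p}) ` partitions (verts G')
      = (\<lambda>C. {d \<in> ?E. ?c d \<in> C}) ` Cut G' ` partitions (verts G')"
    by (simp add: image_image)
  also have "\<dots> = (\<lambda>A. {d \<in> ?E. ?c d \<in> crossing G' A}) ` Pow (verts G')"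
    unfolding Cut_image_partitions[OF G'_simple] by (simp add: image_image)
  also have "\<dots> = {D \<in> ?\<D>. {u, v} \<notin> D}"
    unfolding G' by (rule contract_crossings[OF G uv w])
  finally have "graded_iso (cut_algebra G') (polytopal_algebra F :: ('v set yzvar, 'k) mpoly graded_algebra)
      (cut_hom ?E ?c e')"
    \<comment> \<open>This supplies the surjectivity of edge gluing onto the edges of
      \<open>G'\<close>, on which injectivity of the map rests.\<close>
    using fin edges_contract[OF G uv w]
    by (intro cut_algebra_iso[OF G'_simple e']) (simp_all add: lattice_F G')
  then have "face_retract (cut_algebra G' :: ('v set stvar, 'k) mpoly graded_algebra)
      (cut_algebra G) ?P (cut_hom (edges G) id {u, v})"
    using \<Phi> \<open>F face_of ?P\<close>
    by (intro face_retractI[OF cut_algebra_def cut_algebra_def _ coordinate_face_projection])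
      (simp_all add: F_def)
  moreover have "natural_cut_iso G (cut_hom (edges G) id {u, v} :: ('v set stvar, 'k) mpoly \<Rightarrow> _)"
    unfolding natural_cut_iso_def
    using \<Phi> \<open>\<And>p. {d \<in> edges G. id d \<in> Cut G p} = Cut G p\<close>
    by (simp add: cut_hom_cut_monomial[OF fin fin uv])
  ultimately show ?thesis by blast
qed

end
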